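(* Let $L_1,L_2,C_1,C_2,R>0$, let $V_{\mathrm{in}}$ be a real constant, and let $A(\cdot)$ and $B$ be as in the context. Let $0<\varepsilon\le0.5$, $\bar\mu:=0.5-\varepsilon$, $\mathbb{U}:=[-\bar\mu,\bar\mu]$, and let $\mu^*:\mathbb{R}\to\mathbb{U}$. For $x_o\in\mathbb{R}^4$ let $\phi(t,x_o)$ denote the solution that satisfies $\dot\phi(t,x_o)=A(\mu^*(t))\phi(t,x_o)+B\mu^*(t)$ and $\phi(0,x_o)=x_o$. Then there exist positive constants $K$ and $\lambda$ such that for all $t\ge0$ and all $x_o,y_o\in\mathbb{R}^4$, $$\|\phi(t,x_o)-\phi(t,y_o)\|\le Ke^{-\lambda t}\|x_o-y_o\| .$$
   Context: $M'$ denotes the transpose of $M$, and $\|\cdot\|$ the Euclidean norm. Matrices: $P:=\frac12\operatorname{diag}(L_1,L_2,C_1,C_2)$; for $\mu\in[-0.5,0.5]$, $$A(\mu):=\tfrac12P^{-1}\left(A_0^q+\mu E_0^q\right),\qquad A_0^q=\begin{bmatrix}0&0&-0.5&0\\0&0&0.5&1\\0.5&-0.5&0&0\\0&-1&0&-1/R\end{bmatrix},\qquad E_0^q=\begin{bmatrix}0&0&1&0\\0&0&1&0\\-1&-1&0&0\\0&0&0&0\end{bmatrix};$$ $$B:=\tfrac12P^{-1}\,[\,2V_{\mathrm{in}}\ \ 2V_{\mathrm{in}}\ \ 0\ \ 0\,]'.$$ A solution is a locally absolutely continuous function of $t$ satisfying the differential equation for almost every $t$. (The system $\dot x=A(\mu)x+B\mu$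 is the averaged model of a semi-quasi-Z-source inverter with resistive load $R$, where $\mu+0.5$ is the duty cycle.) *)

theory Defs
  imports "HOL-Analysis.Analysis"
begin

text \<open>
  Absolute continuity on \<open>[a, b]\<close>. A set \<open>D\<close> with \<open>D division_of \<Union>D\<close> is exactly a finite family of
  nonempty compact intervals with pairwise disjoint interiors; the endpoints of such an interval \<open>k\<close>
  are \<open>Inf k\<close> and \<open>Sup k\<close>.
\<close>

definition absolutely_continuous_between ::
    "(real \<Rightarrow> 'a::real_normed_vector) \<Rightarrow> real \<Rightarrow> real \<Rightarrow> bool" where
  "absolutely_continuous_between x a b \<longleftrightarrow>
     (\<forall>e>0. \<exists>d>0. \<forall>D. D division_of \<Union>D \<longrightarrow> \<Union>D \<subseteq> {a..b} \<longrightarrow>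
        (\<Sum>k\<in>D. Sup k - Inf k) < d \<longrightarrow> (\<Sum>k\<in>D. norm (x (Sup k) - x (Inf k))) < e)"

definition locally_absolutely_continuous :: "(real \<Rightarrow> 'a::real_normed_vector) \<Rightarrow> bool" where
  "locally_absolutely_continuous x \<longleftrightarrow> (\<forall>a b. absolutely_continuous_between x a b)"

definition caratheodory_solution ::
    "(real \<Rightarrow> 'a \<Rightarrow> 'a) \<Rightarrow> (real \<Rightarrow> 'a::real_normed_vector) \<Rightarrow> bool" where
  "caratheodory_solution f x \<longleftrightarrow>
     locally_absolutely_continuous x \<and>
     (AE t in lebesgue. (x has_vector_derivative f t (x t)) (at t))"

definition diag_mat :: "real ^ 'n \<Rightarrow> real ^ 'n ^ 'n" where
  "diag_mat v = (\<chi> i j. if i = j then v $ i else 0)"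

definition P_mat :: "real \<Rightarrow> real \<Rightarrow> real \<Rightarrow> real \<Rightarrow> real ^ 4 ^ 4" where
  "P_mat L1 L2 C1 C2 = (1/2) *\<^sub>R diag_mat (vector [L1, L2, C1, C2])"

definition A0q :: "real \<Rightarrow> real ^ 4 ^ 4" where
  "A0q R = vector
     [vector [0,    0,   -0.5,  0],
      vector [0,    0,    0.5,  1],
      vector [0.5, -0.5,  0,    0],
      vector [0,   -1,    0,   -1/R]]"

definition E0q :: "real ^ 4 ^ 4" where
  "E0q = vector
     [vector [ 0,  0, 1, 0],
      vector [ 0,  0, 1, 0],
      vector [-1, -1, 0, 0],
      vector [ 0,  0, 0, 0]]"

definition A_mat ::
    "real \<Rightarrow> real \<Rightarrow> real \<Rightarrow> real \<Rightarrow> real \<Rightarrow> real \<Rightarrow> real ^ 4 ^ 4" where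
  "A_mat L1 L2 C1 C2 R \<mu> =
     (1/2) *\<^sub>R (matrix_inv (P_mat L1 L2 C1 C2) ** (A0q R + \<mu> *\<^sub>R E0q))"

definition B_vec ::
    "real \<Rightarrow> real \<Rightarrow> real \<Rightarrow> real \<Rightarrow> real \<Rightarrow> real ^ 4" where
  "B_vec L1 L2 C1 C2 Vin =
     (1/2) *\<^sub>R (matrix_inv (P_mat L1 L2 C1 C2) *v vector [2 * Vin, 2 * Vin, 0, 0])"

end

theory Submission
  imports Defs
begin

text \<open>
  The difference \<open>z\<close> of two solutions solves the homogeneous equation with matrix \<open>A(\<mu>\<^sup>*(t))\<close>. The energy \<open>z' P z\<close> decreases only at
  the rate \<open>(z\<^sub>4)\<^sup>2 / R\<close>, but dissipation in the fourth component propagates along the chain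
  4, 2, 3, 1: because \<open>1/2 - \<mu>\<close> and \<open>1/2 + \<mu>\<close> stay above \<open>\<epsilon>\<close>, the derivatives of
  \<open>z\<^sub>2 z\<^sub>4\<close>, \<open>- z\<^sub>2 z\<^sub>3\<close> and \<open>- z\<^sub>1 z\<^sub>3\<close> supply the terms \<open>- (z\<^sub>2)\<^sup>2\<close>, \<open>- (z\<^sub>3)\<^sup>2\<close> and
  \<open>- (z\<^sub>1)\<^sup>2\<close>. Adding these products to the energy with small, suitably ordered weights gives a strict
  quadratic Lyapunov function that is the same for every \<open>\<mu>\<close>, so the way in which
  \<open>\<mu>\<^sup>*\<close> depends on time plays no role. An absolutely continuous function whose derivative is almost everywhere
  nonpositive is nonincreasing, and this turns the differential inequality into exponential decay.
\<close>

subsection \<open>Absolutely continuous functions\<close>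

lemma division_real_interval:
  fixes D :: "real set set"
  assumes "D division_of S" "k \<in> D"
  obtains u v where "k = {u..v}" "u \<le> v" "Inf k = u" "Sup k = v"
proof -
  obtain u v where "k = cbox u v" "k \<noteq> {}"
    using division_ofD(3,4)[OF assms] by metis
  then show ?thesis
    using that by auto
qed

lemma absolutely_continuous_betweenE:
  assumes "absolutely_continuous_between x a b" "e > 0"
  obtains d where "d > 0"
    "\<And>D. D division_of \<Union>D \<Longrightarrow> \<Union>D \<subseteq> {a..b} \<Longrightarrow>
        (\<Sum>k\<in>D. Sup k - Inf k) < d \<Longrightarrow> (\<Sum>k\<in>D. norm (x (Sup k) - x (Inf k))) < e"
proof -
  have "\<exists>d>0. \<forall>D. D division_of \<Union>D \<longrightarrow> \<Union>D \<subseteq> {a..b} \<longrightarrow>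
      (\<Sum>k\<in>D. Sup k - Inf k) < d \<longrightarrow> (\<Sum>k\<in>D. norm (x (Sup k) - x (Inf k))) < e"
    using assms unfolding absolutely_continuous_between_def by simp
  with that show ?thesis by blast
qed

text \<open>
  Cousin's lemma gives a tagged division of \<open>[a, b]\<close> such that the intervals tagged by exceptional points lie in
  an open set of small measure, where absolute continuity applies; on the others the derivative bounds the increment.
\<close>

lemma AE_nonpos_derivative_imp_decreasing:
  fixes g :: "real \<Rightarrow> real"
  assumes ac: "absolutely_continuous_between g a b" and "a \<le> b"
    and der: "AE t in lebesgue. \<exists>g'\<le>0. (g has_real_derivative g') (at t)"
  shows "g b \<le> g a"
proof -
  obtain N where N: "negligible N"
      and dN: "\<And>t. t \<notin> N \<Longrightarrow> \<exists>g'\<le>0. (g has_real_derivative g') (at t)"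
    using der unfolding eventually_ae_filter_negligible by blast
  \<comment> \<open>Intervals tagged in the null set \<open>N\<close> contribute less than
    \<open>e\<close>, all others together at most \<open>e * (b - a)\<close>.\<close>
  have "g b - g a \<le> e * (1 + (b - a))" if "e > 0" for e
  proof -
    obtain d where "d > 0" and d: "\<And>D. D division_of \<Union>D \<Longrightarrow> \<Union>D \<subseteq> {a..b} \<Longrightarrow>
        (\<Sum>k\<in>D. Sup k - Inf k) < d \<Longrightarrow> (\<Sum>k\<in>D. norm (g (Sup k) - g (Inf k))) < e"
      using absolutely_continuous_betweenE[OF ac \<open>e > 0\<close>] by blast
    obtain G where "open G" "N \<subseteq> G" and GN: "G - N \<in> lmeasurable"
        "emeasure lebesgue (G - N) < ennreal d"
      using sets_lebesgue_outer_open[of N d] N \<open>d > 0\<close>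
      by (metis negligible_imp_measurable fmeasurableD)
    have G: "G \<in> lmeasurable"
      using fmeasurable.Un[OF GN(1) negligible_imp_measurable[OF N]] \<open>N \<subseteq> G\<close>
      by (simp add: Un_absorb2)
    have "measure lebesgue G = measure lebesgue (G - N)"
      by (rule measure_negligible_symdiff[OF GN(1)])
         (use N in \<open>auto intro: negligible_subset\<close>)
    then have mG: "measure lebesgue G < d"
      using GN \<open>d > 0\<close> by (simp add: emeasure_eq_measure2 ennreal_less_iff)
    \<comment> \<open>The gauge has two regimes: at a point of \<open>N\<close> the ball must stay
      inside \<open>G\<close>; elsewhere it is small enough for the first-order expansion with error
      \<open>e\<close>.\<close>
    have "\<exists>r>0. if t \<in> N then ball t r \<subseteq> G
        else \<forall>u v. u \<le> t \<longrightarrow> t \<le> v \<longrightarrow> {u..v} \<subseteq> ball t r \<longrightarrow> g v - g u \<le> e * (v - u)" for t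
    proof (cases "t \<in> N")
      case True
      then show ?thesis
        using \<open>open G\<close> \<open>N \<subseteq> G\<close> by (auto simp: open_contains_ball)
    next
      case False
      then obtain g' where "g' \<le> 0" "(g has_real_derivative g') (at t)"
        using dN by blast
      then obtain r where "r > 0"
          and r: "\<And>y. \<bar>y - t\<bar> < r \<Longrightarrow> \<bar>g y - g t - g' * (y - t)\<bar> \<le> e * \<bar>y - t\<bar>"
        using \<open>e > 0\<close> unfolding has_field_derivative_def has_derivative_at_alt real_norm_def by blast
      \<comment> \<open>Straddle estimate: as \<open>t\<close> lies between \<open>u\<close> and
        \<open>v\<close>, the linear terms have the favourable sign and the two errors add up to
        \<open>e * (v - u)\<close>.\<close>
      have "g v - g u \<le> e * (v - u)" if "u \<le> t" "t \<le> v" "{u..v} \<subseteq> ball t r" for u v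
      proof -
        have "u \<in> {u..v}" "v \<in> {u..v}"
          using that by auto
        then have "u \<in> ball t r" "v \<in> ball t r"
          using that(3) by blast+
        then have "\<bar>g v - g t - g' * (v - t)\<bar> \<le> e * (v - t)"
          "\<bar>g u - g t - g' * (u - t)\<bar> \<le> e * (t - u)"
          using r[of u] r[of v] that by (auto simp: dist_real_def)
        moreover have "g' * (v - t) \<le> 0" "g' * (u - t) \<ge> 0"
          using \<open>g' \<le> 0\<close> that by (auto simp: mult_nonpos_nonneg mult_nonpos_nonpos)
        moreover have "e * (v - t) + e * (t - u) = e * (v - u)"
          by (simp add: algebra_simps)
        ultimately show ?thesis by linarith
      qed
      with \<open>r > 0\<close> False show ?thesis by auto
    qed
    then obtain r where r: "\<And>t. r t > 0" and rG: "\<And>t. t \<in> N \<Longrightarrow> ball t (r t) \<subseteq> G"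
      and rg: "\<And>t u v. t \<notin> N \<Longrightarrow> u \<le> t \<Longrightarrow> t \<le> v \<Longrightarrow> {u..v} \<subseteq> ball t (r t)
         \<Longrightarrow> g v - g u \<le> e * (v - u)"
      by metis
    have "gauge (\<lambda>t. ball t (r t))"
      using r by (auto simp: gauge_def)
    then obtain p where p: "p tagged_division_of {a..b}" and fine: "(\<lambda>t. ball t (r t)) fine p"
      using fine_division_exists_real by blast
    define q where "q = {(x, k). (x, k) \<in> p \<and> x \<in> N}"
    have "q \<subseteq> p" by (auto simp: q_def)
    have "finite p" using p by blast
    have "q tagged_partial_division_of {a..b}"
      using p \<open>q \<subseteq> p\<close> tagged_partial_division_subset unfolding tagged_division_of_def by blast
    then have q: "q tagged_division_of \<Union>(snd ` q)"
      by (rule tagged_partial_division_of_Union_self)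
    define D where "D = snd ` q"
    have D: "D division_of \<Union>D"
      unfolding D_def using q by (rule division_of_tagged_division)
    have "\<Union>D \<subseteq> {a..b}"
      using tagged_division_ofD(3)[OF p] \<open>q \<subseteq> p\<close> by (fastforce simp: D_def)
    have "\<Union>D \<subseteq> G"
      using fine rG by (fastforce simp: D_def q_def fine_def)
    \<comment> \<open>The total length of \<open>D\<close> is the measure of its union, which lies
      in \<open>G\<close> because the tags are in \<open>N\<close>; hence it is below
      \<open>d\<close>.\<close>
    have "(\<Sum>k\<in>D. Sup k - Inf k) = (\<Sum>k\<in>D. measure lebesgue k)"
      by (rule sum.cong) (auto elim!: division_real_interval[OF D])
    also have "\<dots> = measure lebesgue (\<Union>D)"
      using content_division[OF D] by simp
    also have "\<dots> \<le> measure lebesgue G"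
      using D \<open>\<Union>D \<subseteq> G\<close> G by (intro measure_mono_fmeasurable) (auto simp: lmeasurable_division fmeasurableD)
    finally have "(\<Sum>k\<in>D. norm (g (Sup k) - g (Inf k))) < e"
      using d[OF D \<open>\<Union>D \<subseteq> {a..b}\<close>] mG by simp
    then have "(\<Sum>k\<in>D. g (Sup k) - g (Inf k)) < e"
      by (smt (verit) sum_mono real_norm_def)
    \<comment> \<open>Distinct tags may share a degenerate interval, so passing between
      \<open>D\<close> and \<open>q\<close> needs a summand that vanishes on every interval with
      empty interior. The guard covers the empty one.\<close>
    also have "(\<Sum>k\<in>D. g (Sup k) - g (Inf k)) = (\<Sum>k\<in>D. if k = {} then 0 else g (Sup k) - g (Inf k))"
      using division_ofD(3)[OF D] by (intro sum.cong) auto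
    also have "\<dots> = (\<Sum>(x,k)\<in>q. if k = {} then 0 else g (Sup k) - g (Inf k))"
      unfolding D_def by (rule sum.over_tagged_division_lemma[OF q, symmetric])
        (auto simp: le_less)
    also have "\<dots> = (\<Sum>(x,k)\<in>q. g (Sup k) - g (Inf k))"
      using tagged_division_ofD(2)[OF p] \<open>q \<subseteq> p\<close> by (intro sum.cong) fastforce+
    finally have qe: "(\<Sum>(x,k)\<in>q. g (Sup k) - g (Inf k)) < e" .
    have "(\<Sum>(x,k)\<in>p - q. g (Sup k) - g (Inf k)) \<le> (\<Sum>(x,k)\<in>p - q. e * (Sup k - Inf k))"
    proof (rule sum_mono, clarify)
      fix x k assume xk: "(x, k) \<in> p" "(x, k) \<notin> q"
      then obtain u v where uv: "k = {u..v}" "x \<in> k"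
        using tagged_division_ofD(2,4)[OF p] by (metis box_real(2))
      then show "g (Sup k) - g (Inf k) \<le> e * (Sup k - Inf k)"
        using rg[of x u v] xk fine by (auto simp: q_def fine_def)
    qed
    also have "\<dots> \<le> (\<Sum>(x,k)\<in>p. e * (Sup k - Inf k))"
    proof (rule sum_mono2[OF \<open>finite p\<close>])
      fix z assume z: "z \<in> p - (p - q)"
      obtain x k where xk: "z = (x, k)" by force
      with z obtain u v where uv: "k = {u..v}" "x \<in> k"
        using tagged_division_ofD(2,4)[OF p] by (metis box_real(2) DiffD1)
      then show "0 \<le> (case z of (x, k) \<Rightarrow> e * (Sup k - Inf k))"
        using \<open>e > 0\<close> xk by auto
    qed auto
    also have "\<dots> = e * (b - a)"
      using additive_tagged_division_1[OF \<open>a \<le> b\<close> p, of "\<lambda>t. t"]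
      by (simp add: case_prod_unfold flip: sum_distrib_left)
    finally have "(\<Sum>(x,k)\<in>p - q. g (Sup k) - g (Inf k)) \<le> e * (b - a)" .
    moreover have "(\<Sum>(x,k)\<in>p. g (Sup k) - g (Inf k)) =
       (\<Sum>(x,k)\<in>p - q. g (Sup k) - g (Inf k)) + (\<Sum>(x,k)\<in>q. g (Sup k) - g (Inf k))"
      by (rule sum.subset_diff[OF \<open>q \<subseteq> p\<close> \<open>finite p\<close>])
    ultimately show ?thesis
      using additive_tagged_division_1[OF \<open>a \<le> b\<close> p, of g] qe by (simp add: algebra_simps)
  qed
  \<comment> \<open>Let \<open>e\<close> tend to 0, after division by the positive factor
    \<open>1 + (b - a)\<close>.\<close>
  then have "(g b - g a) / (1 + (b - a)) \<le> e" if "e > 0" for e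
    using \<open>a \<le> b\<close> that by (subst pos_divide_le_eq) auto
  then have "(g b - g a) / (1 + (b - a)) \<le> 0 + e" if "e > 0" for e
    using that by simp
  then have "(g b - g a) / (1 + (b - a)) \<le> 0"
    by (rule field_le_epsilon)
  then show ?thesis
    using \<open>a \<le> b\<close> by (simp add: divide_le_0_iff)
qed

section \<open>Closure properties of absolute continuity\<close>

text \<open>The common source of the closure properties below: increments of \<open>h\<close> are
  dominated by those of \<open>x\<close> and \<open>y\<close>, each granted half of
  \<open>e\<close>. One-function cases take \<open>y = x\<close>.\<close>

lemma absolutely_continuous_between_lipschitz_comp:
  fixes x :: "real \<Rightarrow> 'a::real_normed_vector" and y :: "real \<Rightarrow> 'b::real_normed_vector"
    and h :: "real \<Rightarrow> 'c::real_normed_vector"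
  assumes x: "absolutely_continuous_between x a b" and y: "absolutely_continuous_between y a b"
    and lip: "\<And>u v. u \<in> {a..b} \<Longrightarrow> v \<in> {a..b} \<Longrightarrow>
      norm (h v - h u) \<le> c * norm (x v - x u) + c * norm (y v - y u)"
  shows "absolutely_continuous_between h a b"
  unfolding absolutely_continuous_between_def
proof (intro allI impI)
  fix e :: real assume "e > 0"
  \<comment> \<open>The sign of \<open>c\<close> is arbitrary, while \<open>e / (2 * C)\<close>
    requires a strictly positive constant.\<close>
  define C where "C = \<bar>c\<bar> + 1"
  have "C > 0" "c \<le> C" by (auto simp: C_def)
  then have "e / (2 * C) > 0" using \<open>e > 0\<close> by simp
  then obtain d1 where "d1 > 0"
    and d1: "\<And>D. D division_of \<Union>D \<Longrightarrow> \<Union>D \<subseteq> {a..b} \<Longrightarrow>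
        (\<Sum>k\<in>D. Sup k - Inf k) < d1 \<Longrightarrow> (\<Sum>k\<in>D. norm (x (Sup k) - x (Inf k))) < e / (2 * C)"
    using absolutely_continuous_betweenE[OF x] by blast
  obtain d2 where "d2 > 0"
    and d2: "\<And>D. D division_of \<Union>D \<Longrightarrow> \<Union>D \<subseteq> {a..b} \<Longrightarrow>
        (\<Sum>k\<in>D. Sup k - Inf k) < d2 \<Longrightarrow> (\<Sum>k\<in>D. norm (y (Sup k) - y (Inf k))) < e / (2 * C)"
    using absolutely_continuous_betweenE[OF y \<open>e / (2 * C) > 0\<close>] by blast
  have "(\<Sum>k\<in>D. norm (h (Sup k) - h (Inf k))) < e"
    if D: "D division_of \<Union>D" and sub: "\<Union>D \<subseteq> {a..b}" and l: "(\<Sum>k\<in>D. Sup k - Inf k) < min d1 d2" for D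
  proof -
    have "(\<Sum>k\<in>D. norm (h (Sup k) - h (Inf k)))
        \<le> (\<Sum>k\<in>D. C * norm (x (Sup k) - x (Inf k)) + C * norm (y (Sup k) - y (Inf k)))"
    proof (rule sum_mono)
      fix k assume "k \<in> D"
      then obtain u v where "k = {u..v}" "u \<le> v" "Inf k = u" "Sup k = v"
        by (rule division_real_interval[OF D])
      moreover have "k \<subseteq> {a..b}" using \<open>k \<in> D\<close> sub by blast
      ultimately have "norm (h (Sup k) - h (Inf k))
          \<le> c * norm (x (Sup k) - x (Inf k)) + c * norm (y (Sup k) - y (Inf k))"
        using lip[of "Inf k" "Sup k"] by auto
      also have "\<dots> \<le> C * norm (x (Sup k) - x (Inf k)) + C * norm (y (Sup k) - y (Inf k))"
        using \<open>c \<le> C\<close> by (intro add_mono mult_right_mono) auto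
      finally show "norm (h (Sup k) - h (Inf k)) \<le> \<dots>" .
    qed
    also have "\<dots> = C * (\<Sum>k\<in>D. norm (x (Sup k) - x (Inf k))) + C * (\<Sum>k\<in>D. norm (y (Sup k) - y (Inf k)))"
      by (simp add: sum.distrib sum_distrib_left)
    also have "\<dots> < C * (e / (2 * C)) + C * (e / (2 * C))"
      using \<open>C > 0\<close> d1[OF D sub] d2[OF D sub] l by (intro add_strict_mono mult_strict_left_mono) auto
    also have "\<dots> = e" using \<open>C > 0\<close> by (simp add: field_simps)
    finally show ?thesis .
  qed
  then show "\<exists>d>0. \<forall>D. D division_of \<Union>D \<longrightarrow> \<Union>D \<subseteq> {a..b} \<longrightarrow>
        (\<Sum>k\<in>D. Sup k - Inf k) < d \<longrightarrow> (\<Sum>k\<in>D. norm (h (Sup k) - h (Inf k))) < e"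
    using \<open>d1 > 0\<close> \<open>d2 > 0\<close> by (intro exI[of _ "min d1 d2"]) auto
qed

text \<open>The one-element division \<open>{{u..v}}\<close> turns absolute continuity into a
  modulus of continuity. This serves to bound the factors of a product.\<close>

lemma absolutely_continuous_between_imp_continuous_on:
  fixes x :: "real \<Rightarrow> 'a::real_normed_vector"
  assumes "absolutely_continuous_between x a b"
  shows "continuous_on {a..b} x"
  unfolding continuous_on_iff
proof (intro ballI allI impI)
  fix t e :: real assume t: "t \<in> {a..b}" and "e > 0"
  then obtain d where "d > 0" and d: "\<And>D. D division_of \<Union>D \<Longrightarrow> \<Union>D \<subseteq> {a..b} \<Longrightarrow>
        (\<Sum>k\<in>D. Sup k - Inf k) < d \<Longrightarrow> (\<Sum>k\<in>D. norm (x (Sup k) - x (Inf k))) < e"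
    using absolutely_continuous_betweenE[OF assms] by blast
  have close: "dist (x v) (x u) < e" if "a \<le> u" "u \<le> v" "v \<le> b" "v - u < d" for u v
    using d[of "{{u..v}}"] that division_of_self[of u v] by (auto simp: cbox_interval dist_norm)
  have "dist (x s) (x t) < e" if s: "s \<in> {a..b}" "dist s t < d" for s
  proof (cases "s \<le> t")
    case True
    then show ?thesis
      using close[of s t] s t by (simp add: dist_real_def dist_commute)
  next
    case False
    then show ?thesis
      using close[of t s] s t by (simp add: dist_real_def)
  qed
  then show "\<exists>d>0. \<forall>x'\<in>{a..b}. dist x' t < d \<longrightarrow> dist (x x') (x t) < e"
    using \<open>d > 0\<close> by blast
qed

lemma absolutely_continuous_between_add:
  assumes "absolutely_continuous_between x a b" "absolutely_continuous_between y a b"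
  shows "absolutely_continuous_between (\<lambda>t. x t + y t) a b"
  by (rule absolutely_continuous_between_lipschitz_comp[OF assms, of _ 1])
     (simp add: norm_diff_triangle_ineq)

lemma absolutely_continuous_between_diff:
  assumes "absolutely_continuous_between x a b" "absolutely_continuous_between y a b"
  shows "absolutely_continuous_between (\<lambda>t. x t - y t) a b"
proof (rule absolutely_continuous_between_lipschitz_comp[OF assms])
  fix u v
  have "x v - y v - (x u - y u) = (x v - x u) - (y v - y u)"
    by simp
  then show "norm (x v - y v - (x u - y u)) \<le> 1 * norm (x v - x u) + 1 * norm (y v - y u)"
    by (metis norm_triangle_ineq4 mult_1)
qed

text \<open>Comparison with the identity function, for which \<open>d = e\<close> works because
  interval lengths are nonnegative.\<close>

lemma absolutely_continuous_between_of_lipschitz: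
  fixes x :: "real \<Rightarrow> 'a::real_normed_vector"
  assumes "C-lipschitz_on {a..b} x"
  shows "absolutely_continuous_between x a b"
proof (rule absolutely_continuous_between_lipschitz_comp)
  show "absolutely_continuous_between (\<lambda>t::real. t) a b"
    unfolding absolutely_continuous_between_def
  proof (intro allI impI exI conjI)
    fix e :: real and D :: "real set set"
    assume "D division_of \<Union>D" and l: "(\<Sum>k\<in>D. Sup k - Inf k) < e"
    then have "(\<Sum>k\<in>D. norm (Sup k - Inf k)) = (\<Sum>k\<in>D. Sup k - Inf k)"
      by (intro sum.cong) (auto elim!: division_real_interval)
    with l show "(\<Sum>k\<in>D. norm (Sup k - Inf k)) < e" by simp
  qed
  then show "absolutely_continuous_between (\<lambda>t::real. t) a b" .
  fix u v assume "u \<in> {a..b}" "v \<in> {a..b}"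
  then have "norm (x v - x u) \<le> C * norm (v - u)"
    using lipschitz_onD[OF assms] by (simp add: dist_norm)
  moreover have "0 \<le> C * norm (v - u)"
    using lipschitz_on_nonneg[OF assms] by simp
  ultimately show "norm (x v - x u) \<le> C * norm (v - u) + C * norm (v - u)"
    by linarith
qed

text \<open>Both factors are continuous, hence bounded on the compact interval, so the increment of
  the product is controlled by those of the factors.\<close>

lemma absolutely_continuous_between_mult:
  fixes x y :: "real \<Rightarrow> real"
  assumes x: "absolutely_continuous_between x a b" and y: "absolutely_continuous_between y a b"
  shows "absolutely_continuous_between (\<lambda>t. x t * y t) a b"
proof -
  have "bounded (x ` {a..b})" "bounded (y ` {a..b})"
    using x y by (auto intro!: compact_imp_bounded compact_continuous_image
        absolutely_continuous_between_imp_continuous_on)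
  then obtain B1 B2 where B1: "\<And>t. t \<in> {a..b} \<Longrightarrow> \<bar>x t\<bar> \<le> B1" and B2: "\<And>t. t \<in> {a..b} \<Longrightarrow> \<bar>y t\<bar> \<le> B2"
    unfolding bounded_iff by (metis imageI real_norm_def)
  show ?thesis
  proof (rule absolutely_continuous_between_lipschitz_comp[OF x y])
    fix u v assume uv: "u \<in> {a..b}" "v \<in> {a..b}"
    let ?C = "max B1 B2"
    have "x v * y v - x u * y u = y v * (x v - x u) + x u * (y v - y u)"
      by (simp add: algebra_simps)
    then have "\<bar>x v * y v - x u * y u\<bar> \<le> \<bar>y v\<bar> * \<bar>x v - x u\<bar> + \<bar>x u\<bar> * \<bar>y v - y u\<bar>"
      by (metis abs_mult abs_triangle_ineq)
    also have "\<dots> \<le> ?C * \<bar>x v - x u\<bar> + ?C * \<bar>y v - y u\<bar>"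
      using B1[OF uv(1)] B2[OF uv(2)] by (intro add_mono mult_right_mono) auto
    finally show "norm (x v * y v - x u * y u) \<le> ?C * norm (x v - x u) + ?C * norm (y v - y u)"
      by simp
  qed
qed

lemma absolutely_continuous_between_const: "absolutely_continuous_between (\<lambda>t. c) a b"
  by (rule absolutely_continuous_between_of_lipschitz[where C = 0]) (simp add: lipschitz_on_def)

lemma absolutely_continuous_between_vec_nth:
  fixes x :: "real \<Rightarrow> real ^ 'n"
  assumes "absolutely_continuous_between x a b"
  shows "absolutely_continuous_between (\<lambda>t. x t $ i) a b"
proof (rule absolutely_continuous_between_lipschitz_comp[OF assms assms])
  fix u v
  have "\<bar>(x v - x u) $ i\<bar> \<le> norm (x v - x u)"
    by (rule component_le_norm_cart)
  then show "norm (x v $ i - x u $ i) \<le> 1 * norm (x v - x u) + 1 * norm (x v - x u)"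
    by (simp add: add_increasing)
qed

lemma absolutely_continuous_between_exp: "absolutely_continuous_between (\<lambda>t. exp (c * t)) a b"
proof -
  have "continuous_on {a..b} (\<lambda>t. c * exp (c * t))"
    by (intro continuous_intros)
  then have "bounded ((\<lambda>t. c * exp (c * t)) ` {a..b})"
    by (intro compact_imp_bounded compact_continuous_image) auto
  then obtain B where "B > 0" and B: "\<And>t. t \<in> {a..b} \<Longrightarrow> \<bar>c * exp (c * t)\<bar> \<le> B"
    unfolding bounded_pos real_norm_def by blast
  have "B-lipschitz_on {a..b} (\<lambda>t. exp (c * t))"
  proof (rule bounded_derivative_imp_lipschitz)
    show "((\<lambda>t. exp (c * t)) has_derivative (\<lambda>h. c * exp (c * t) * h)) (at t within {a..b})" for t
      by (auto intro!: derivative_eq_intros)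
    show "onorm (\<lambda>h. c * exp (c * t) * h) \<le> B" if "t \<in> {a..b}" for t
      using B[OF that] by (intro onorm_le) (metis abs_mult mult_right_mono real_norm_def norm_ge_zero)
  qed (use \<open>B > 0\<close> in auto)
  then show ?thesis by (rule absolutely_continuous_between_of_lipschitz)
qed

subsection \<open>The averaged system in coordinates\<close>

lemma vector_4 [simp]:
  "(vector [x, y, z, w] :: 'a::zero ^ 4) $ 1 = x"
  "(vector [x, y, z, w] :: 'a::zero ^ 4) $ 2 = y"
  "(vector [x, y, z, w] :: 'a::zero ^ 4) $ 3 = z"
  "(vector [x, y, z, w] :: 'a::zero ^ 4) $ 4 = w"
  unfolding vector_def by simp_all

text \<open>\<open>matrix_inv\<close> is a choice operator: exhibiting \<open>B\<close> shows that
  there is something to choose, and associativity forces the chosen inverse to be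
  \<open>B\<close>.\<close>

lemma matrix_inv_unique:
  fixes A :: "'a::semiring_1 ^ 'n ^ 'n"
  assumes "A ** B = mat 1" "B ** A = mat 1"
  shows "matrix_inv A = B"
proof -
  have "A ** matrix_inv A = mat 1"
    unfolding matrix_inv_def by (rule someI2[of _ B]) (use assms in auto)
  then have "B ** (A ** matrix_inv A) = B"
    by simp
  then show ?thesis
    using assms(2) by (simp add: matrix_mul_assoc)
qed

lemma diag_mat_mult: "diag_mat u ** diag_mat v = diag_mat (u * v)"
proof -
  have "(\<Sum>k\<in>UNIV. (if i = k then u $ i else 0) * (if k = j then v $ k else 0))
      = (\<Sum>k\<in>UNIV. if i = k then u $ i * (if k = j then v $ k else 0) else 0)" for i j
    by (rule sum.cong) auto
  then show ?thesis
    by (simp add: diag_mat_def matrix_matrix_mult_def vec_eq_iff)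
qed

lemma diag_mat_mult_vector: "(diag_mat v *v x) $ i = v $ i * x $ i"
proof -
  have "(\<Sum>k\<in>UNIV. (if i = k then v $ i else 0) * x $ k) = (\<Sum>k\<in>UNIV. if i = k then v $ i * x $ k else 0)"
    by (rule sum.cong) auto
  then show ?thesis
    by (simp add: diag_mat_def matrix_vector_mult_def)
qed

lemma matrix_inv_P_mat:
  assumes "L1 > 0" "L2 > 0" "C1 > 0" "C2 > 0"
  shows "matrix_inv (P_mat L1 L2 C1 C2) = diag_mat (vector [2 / L1, 2 / L2, 2 / C1, 2 / C2])"
proof (rule matrix_inv_unique)
  have P: "P_mat L1 L2 C1 C2 = diag_mat (vector [L1 / 2, L2 / 2, C1 / 2, C2 / 2])"
    by (simp add: P_mat_def diag_mat_def vec_eq_iff forall_4)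
  have one: "diag_mat (vector [1, 1, 1, 1]) = (mat 1 :: real ^ 4 ^ 4)"
    by (simp add: diag_mat_def mat_def vec_eq_iff forall_4)
  have "vector [L1 / 2, L2 / 2, C1 / 2, C2 / 2] * vector [2 / L1, 2 / L2, 2 / C1, 2 / C2]
      = (vector [1, 1, 1, 1] :: real ^ 4)"
    using assms by (simp add: vec_eq_iff forall_4)
  then show "P_mat L1 L2 C1 C2 ** diag_mat (vector [2 / L1, 2 / L2, 2 / C1, 2 / C2]) = mat 1"
    "diag_mat (vector [2 / L1, 2 / L2, 2 / C1, 2 / C2]) ** P_mat L1 L2 C1 C2 = mat 1"
    unfolding P diag_mat_mult mult.commute[of "vector [2 / L1, 2 / L2, 2 / C1, 2 / C2]"] by (simp_all only: one)
qed

text \<open>The factor 1/2 in \<open>A_mat\<close> cancels the 2 from the inverse of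
  \<open>P_mat\<close>, so each row is divided by just its own inductance or capacitance.\<close>

lemma A_mat_mult_vector:
  assumes "L1 > 0" "L2 > 0" "C1 > 0" "C2 > 0"
  shows "A_mat L1 L2 C1 C2 R m *v z = vector
    [- ((1/2 - m) * z $ 3) / L1,
     ((1/2 + m) * z $ 3 + z $ 4) / L2,
     ((1/2 - m) * z $ 1 - (1/2 + m) * z $ 2) / C1,
     - (z $ 2 + z $ 4 / R) / C2]"
proof -
  have "A_mat L1 L2 C1 C2 R m *v z = (1/2) *\<^sub>R
    (diag_mat (vector [2 / L1, 2 / L2, 2 / C1, 2 / C2]) *v ((A0q R + m *\<^sub>R E0q) *v z))"
    by (simp only: A_mat_def matrix_inv_P_mat[OF assms] scaleR_matrix_vector_assoc matrix_vector_mul_assoc)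
  also have "(A0q R + m *\<^sub>R E0q) *v z = vector
    [- ((1/2 - m) * z $ 3), (1/2 + m) * z $ 3 + z $ 4,
     (1/2 - m) * z $ 1 - (1/2 + m) * z $ 2, - (z $ 2 + z $ 4 / R)]"
    by (simp add: vec_eq_iff forall_4 matrix_vector_mult_def sum_4 A0q_def E0q_def algebra_simps)
  also have "(1/2) *\<^sub>R (diag_mat (vector [2 / L1, 2 / L2, 2 / C1, 2 / C2]) *v \<dots>) = vector
    [- ((1/2 - m) * z $ 3) / L1, ((1/2 + m) * z $ 3 + z $ 4) / L2,
     ((1/2 - m) * z $ 1 - (1/2 + m) * z $ 2) / C1, - (z $ 2 + z $ 4 / R) / C2]"
    by (simp add: vec_eq_iff forall_4 diag_mat_mult_vector)
  finally show ?thesis .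
qed

subsection \<open>A strict Lyapunov function\<close>

lemma mult_le_of_abs_le:
  fixes p w :: real
  assumes "\<bar>p\<bar> \<le> c" "\<bar>w\<bar> \<le> q"
  shows "p * w \<le> c * q"
proof -
  have "p * w \<le> \<bar>p\<bar> * \<bar>w\<bar>"
    by (metis abs_ge_self abs_mult)
  also have "\<dots> \<le> c * q"
    using assms by (intro mult_mono) auto
  finally show ?thesis .
qed

lemma abs_mult_le_sum_squares: "\<bar>x * y\<bar> \<le> x\<^sup>2 + (y\<^sup>2 :: real)"
proof -
  have "2 * (\<bar>x\<bar> * \<bar>y\<bar>) \<le> x\<^sup>2 + y\<^sup>2"
    using sum_squares_bound[of "\<bar>x\<bar>" "\<bar>y\<bar>"] by (simp add: mult.assoc)
  moreover have "0 \<le> \<bar>x\<bar> * \<bar>y\<bar>" by simp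
  ultimately show ?thesis unfolding abs_mult by linarith
qed


text \<open>
  With the weights \<open>s\<^sup>8\<close>, \<open>s\<^sup>1\<^sup>4\<close>, \<open>s\<^sup>1\<^sup>8\<close>, and in the variables \<open>z\<^sub>4\<close>, \<open>s\<^sup>4 z\<^sub>2\<close>,
  \<open>s\<^sup>7 z\<^sub>3\<close>, \<open>s\<^sup>9 z\<^sub>1\<close>, the good terms of the derivative have coefficients independent of \<open>s\<close>,
  while every other term carries a positive power of \<open>s\<close>.
\<close>

definition lyapunov :: "real \<Rightarrow> real \<Rightarrow> real \<Rightarrow> real \<Rightarrow> real \<Rightarrow> real ^ 4 \<Rightarrow> real" where
  "lyapunov L1 L2 C1 C2 s z =
     (L1 * (z$1)\<^sup>2 + L2 * (z$2)\<^sup>2 + C1 * (z$3)\<^sup>2 + C2 * (z$4)\<^sup>2) / 2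
     + s^8 * (L2 * C2) * (z$2 * z$4) - s^14 * (L2 * C1) * (z$2 * z$3) - s^18 * (L1 * C1) * (z$1 * z$3)"

text \<open>The derivative of \<open>lyapunov\<close> along the system, with \<open>a = 1/2 - \<mu>\<close> and \<open>b = 1/2 + \<mu>\<close>.\<close>

definition lyapunov_rate ::
    "real \<Rightarrow> real \<Rightarrow> real \<Rightarrow> real \<Rightarrow> real \<Rightarrow> real \<Rightarrow> real \<Rightarrow> real \<Rightarrow> real ^ 4 \<Rightarrow> real" where
  "lyapunov_rate L1 L2 C1 C2 R s a b z =
     - (z$4)\<^sup>2 / R
     + s^8 * (C2 * b * (z$3 * z$4) + C2 * (z$4)\<^sup>2 - L2 * (z$2)\<^sup>2 - L2 / R * (z$2 * z$4))
     - s^14 * (C1 * b * (z$3)\<^sup>2 + C1 * (z$3 * z$4) + L2 * a * (z$1 * z$2) - L2 * b * (z$2)\<^sup>2)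
     + s^18 * (C1 * a * (z$3)\<^sup>2 - L1 * a * (z$1)\<^sup>2 + L1 * b * (z$1 * z$2))"

lemma norm_vec4_squared: "(norm z)\<^sup>2 = (z$1)\<^sup>2 + (z$2)\<^sup>2 + (z$3)\<^sup>2 + ((z :: real ^ 4)$4)\<^sup>2"
  by (simp add: norm_vec_def L2_set_def sum_4 sum_nonneg)

text \<open>Every positive power of \<open>s\<close> is at most \<open>s\<close>, so cross
  coefficients with different exponents share the single bound \<open>M * s\<close>.\<close>

lemma abs_mult_power_le:
  fixes s :: real
  assumes "0 \<le> c" "c \<le> M" "0 < s" "s \<le> 1" "0 < j"
  shows "\<bar>c * s ^ j\<bar> \<le> M * s"
proof -
  have "s ^ j \<le> s"
    using assms power_decreasing[of 1 j s] by simp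
  then have "c * s ^ j \<le> M * s"
    using assms by (intro mult_mono) auto
  then show ?thesis using assms by simp
qed

text \<open>The energy part is at least \<open>m / 2\<close> times the squared norm, and the three
  cross terms together are at most \<open>3 * (M * s)\<close>, hence \<open>m / 4\<close>, times
  it.\<close>

lemma lyapunov_bounds:
  assumes m: "0 < m" "m \<le> L1" "m \<le> L2" "m \<le> C1" "m \<le> C2"
    and M: "L1 \<le> M" "L2 \<le> M" "C1 \<le> M" "C2 \<le> M" "L2 * C2 \<le> M" "L2 * C1 \<le> M" "L1 * C1 \<le> M"
    and s: "0 < s" "s \<le> 1" "16 * (M * s) \<le> m"
  shows "m / 4 * (norm z)\<^sup>2 \<le> lyapunov L1 L2 C1 C2 s z"
    and "lyapunov L1 L2 C1 C2 s z \<le> M * (norm z)\<^sup>2"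
proof -
  let ?n = "(norm z)\<^sup>2"
  have cross: "\<bar>c * s ^ j * (z$i * z$k)\<bar> \<le> M * s * ?n"
    if "0 \<le> c" "c \<le> M" "0 < j" "\<bar>z$i * z$k\<bar> \<le> ?n" for c i k j
    using abs_mult_power_le[OF that(1,2) s(1,2) that(3)] that(4)
    unfolding abs_mult[of "c * s ^ j"] by (intro mult_mono) auto
  have prod: "\<bar>z$2 * z$4\<bar> \<le> ?n" "\<bar>z$2 * z$3\<bar> \<le> ?n" "\<bar>z$1 * z$3\<bar> \<le> ?n"
    using abs_mult_le_sum_squares[of "z$2" "z$4"] abs_mult_le_sum_squares[of "z$2" "z$3"]
      abs_mult_le_sum_squares[of "z$1" "z$3"] unfolding norm_vec4_squared
    by (smt (verit) zero_le_power2)+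
  have c: "\<bar>L2 * C2 * s^8 * (z$2 * z$4)\<bar> \<le> M * s * ?n"
    "\<bar>L2 * C1 * s^14 * (z$2 * z$3)\<bar> \<le> M * s * ?n"
    "\<bar>L1 * C1 * s^18 * (z$1 * z$3)\<bar> \<le> M * s * ?n"
    using m M prod by (intro cross; simp)+
  have Ms: "3 * (M * s * ?n) \<le> m / 4 * ?n"
  proof -
    have "3 * (M * s) * ?n \<le> m / 4 * ?n"
      using s(3) m(1) by (intro mult_right_mono) auto
    then show ?thesis by simp
  qed
  define V where "V = L1 * (z$1)\<^sup>2 + L2 * (z$2)\<^sup>2 + C1 * (z$3)\<^sup>2 + C2 * (z$4)\<^sup>2"
  have W: "lyapunov L1 L2 C1 C2 s z = V / 2 + L2 * C2 * s^8 * (z$2 * z$4)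
      - L2 * C1 * s^14 * (z$2 * z$3) - L1 * C1 * s^18 * (z$1 * z$3)"
    unfolding lyapunov_def V_def by (simp add: mult_ac)
  have V1: "m * ?n \<le> V"
    unfolding norm_vec4_squared V_def distrib_left using m by (intro add_mono mult_right_mono) auto
  have V2: "V \<le> M * ?n"
    unfolding norm_vec4_squared V_def distrib_left using M by (intro add_mono mult_right_mono) auto
  have mM: "m * ?n \<le> M * ?n"
    using m(2) M(1) by (intro mult_right_mono) auto
  have "0 \<le> m * ?n" using m(1) by simp
  show "m / 4 * ?n \<le> lyapunov L1 L2 C1 C2 s z"
    unfolding W using c Ms V1 by linarith
  show "lyapunov L1 L2 C1 C2 s z \<le> M * ?n"
    unfolding W using c Ms V2 mM \<open>0 \<le> m * ?n\<close> by linarith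
qed

text \<open>In the scaled variables the four square terms dissipate at least \<open>m * q\<close>,
  while the eight remaining terms cost at most \<open>8 * (M * s * q)\<close>. The factor 16 in the
  smallness of \<open>s\<close> makes this cost at most half of the dissipation.\<close>

lemma lyapunov_rate_le:
  assumes pos: "0 < L1" "0 < L2" "0 < C1" "0 < C2" "0 < R" "0 < \<epsilon>"
    and ab: "\<epsilon> \<le> a" "a \<le> 1" "\<epsilon> \<le> b" "b \<le> 1"
    and m: "0 < m" "m \<le> 1 / R" "m \<le> L2" "m \<le> C1 * \<epsilon>" "m \<le> L1 * \<epsilon>"
    and M: "L1 \<le> M" "L2 \<le> M" "C1 \<le> M" "C2 \<le> M" "L2 / R \<le> M"
    and s: "0 < s" "s \<le> 1" "16 * (M * s) \<le> m"
  shows "lyapunov_rate L1 L2 C1 C2 R s a b z \<le> - (m / 2 * s^18) * (norm z)\<^sup>2"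
proof -
  define X Y Z T where "X = z$4" "Y = s^4 * z$2" "Z = s^7 * z$3" "T = s^9 * z$1"
  note XYZT = this
  define q where "q = X\<^sup>2 + Y\<^sup>2 + Z\<^sup>2 + T\<^sup>2"
  \<comment> \<open>Good squares first, then eight perturbations. Each of these has, up to sign, a
    coefficient \<open>c * s ^ j\<close> with \<open>0 < j\<close>, which is why \<open>s^1\<close>
    is written out.\<close>
  have rate: "lyapunov_rate L1 L2 C1 C2 R s a b z =
     - (1 / R * X\<^sup>2 + L2 * Y\<^sup>2 + C1 * b * Z\<^sup>2 + L1 * a * T\<^sup>2)
     + (C2 * b * s^1 * (Z * X) + C2 * s^8 * (X * X) + (- (L2 / R * s^4)) * (Y * X)
     + (- (C1 * s^7)) * (Z * X) + (- (L2 * a * s^1)) * (Y * T) + L2 * b * s^6 * (Y * Y)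
     + C1 * a * s^4 * (Z * Z) + L1 * b * s^5 * (Y * T))"
    unfolding lyapunov_rate_def XYZT by (simp add: algebra_simps power2_eq_square power_numeral_reduce)
  have "m * X\<^sup>2 \<le> 1 / R * X\<^sup>2" "m * Y\<^sup>2 \<le> L2 * Y\<^sup>2"
    using m by (auto intro!: mult_right_mono simp del: times_divide_eq_left)
  moreover have "C1 * \<epsilon> \<le> C1 * b" "L1 * \<epsilon> \<le> L1 * a"
    using pos ab by auto
  then have "m * Z\<^sup>2 \<le> C1 * b * Z\<^sup>2" "m * T\<^sup>2 \<le> L1 * a * T\<^sup>2"
    using m by (auto intro!: mult_right_mono)
  ultimately have good: "m * q \<le> 1 / R * X\<^sup>2 + L2 * Y\<^sup>2 + C1 * b * Z\<^sup>2 + L1 * a * T\<^sup>2"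
    unfolding q_def distrib_left by linarith
  have prod: "\<bar>Z * X\<bar> \<le> q" "\<bar>X * X\<bar> \<le> q" "\<bar>Y * X\<bar> \<le> q" "\<bar>Y * T\<bar> \<le> q" "\<bar>Y * Y\<bar> \<le> q" "\<bar>Z * Z\<bar> \<le> q"
    using abs_mult_le_sum_squares[of Z X] abs_mult_le_sum_squares[of Y X] abs_mult_le_sum_squares[of Y T]
      zero_le_power2[of X] zero_le_power2[of Y] zero_le_power2[of Z] zero_le_power2[of T]
    unfolding q_def by (linarith | simp add: power2_eq_square)+
  have ab0: "0 \<le> a" "0 \<le> b" using pos ab by auto
  have scaled: "0 \<le> c * r \<and> c * r \<le> M" if "0 < c" "c \<le> M" "0 \<le> r" "r \<le> 1" for c r
    using that mult_left_le[of r c] mult_nonneg_nonneg[of c r] by linarith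
  have coeff: "\<bar>C2 * b * s^1\<bar> \<le> M * s" "\<bar>C2 * s^8\<bar> \<le> M * s" "\<bar>- (L2 / R * s^4)\<bar> \<le> M * s"
    "\<bar>- (C1 * s^7)\<bar> \<le> M * s" "\<bar>- (L2 * a * s^1)\<bar> \<le> M * s" "\<bar>L2 * b * s^6\<bar> \<le> M * s"
    "\<bar>C1 * a * s^4\<bar> \<le> M * s" "\<bar>L1 * b * s^5\<bar> \<le> M * s"
    unfolding abs_minus_cancel
    by (rule abs_mult_power_le; use pos ab ab0 M s scaled in simp)+
  note bad = coeff[THEN mult_le_of_abs_le]
  have "lyapunov_rate L1 L2 C1 C2 R s a b z \<le> - (m * q) + 8 * (M * s * q)"
    unfolding rate
    using good bad(1)[OF prod(1)] bad(2)[OF prod(2)] bad(3)[OF prod(3)] bad(4)[OF prod(1)]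
      bad(5)[OF prod(4)] bad(6)[OF prod(5)] bad(7)[OF prod(6)] bad(8)[OF prod(4)]
    by linarith
  also have "\<dots> \<le> - (m / 2) * q"
  proof -
    have "0 \<le> q" by (simp add: q_def)
    then have "16 * (M * s) * q \<le> m * q"
      using s(3) by (rule mult_right_mono[rotated])
    then show ?thesis by simp
  qed
  \<comment> \<open>Back in the original variables, the squares in \<open>q\<close> carry the powers
    0, 8, 14 and 18 of \<open>s\<close>; the last is the smallest.\<close>
  also have "\<dots> \<le> - (m / 2) * (s^18 * (norm z)\<^sup>2)"
  proof -
    have "s^18 * x \<le> s^j * x" if "j \<le> 18" "0 \<le> x" for j x
      using that s by (intro mult_right_mono power_decreasing) auto
    from this[of 0 "(z$4)\<^sup>2"] this[of 8 "(z$2)\<^sup>2"] this[of 14 "(z$3)\<^sup>2"]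
    have "s^18 * (norm z)\<^sup>2 \<le> q"
      unfolding q_def XYZT norm_vec4_squared power_mult_distrib distrib_left
      by (simp flip: power_mult)
    then show ?thesis
      using m(1) by (intro mult_left_mono_neg) auto
  qed
  finally show ?thesis by (simp add: mult_ac)
qed

section \<open>The Lyapunov function along solutions\<close>

lemma absolutely_continuous_between_lyapunov:
  assumes "absolutely_continuous_between z a b"
  shows "absolutely_continuous_between (\<lambda>t. lyapunov L1 L2 C1 C2 s (z t)) a b"
  unfolding lyapunov_def divide_inverse power2_eq_square
  by (intro absolutely_continuous_between_add absolutely_continuous_between_diff
      absolutely_continuous_between_mult absolutely_continuous_between_const
      absolutely_continuous_between_vec_nth[OF assms])

text \<open>Multiplying each component equation by its inductance or capacitance removes the
  denominators. In the energy part all products containing \<open>\<mu>\<close> then cancel, leaving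
  only the resistive loss.\<close>

lemma lyapunov_has_derivative:
  assumes pos: "L1 > 0" "L2 > 0" "C1 > 0" "C2 > 0" "R > 0"
    and z: "(z has_vector_derivative A_mat L1 L2 C1 C2 R \<mu> *v z t) (at t)"
  shows "((\<lambda>t. lyapunov L1 L2 C1 C2 s (z t)) has_real_derivative
           lyapunov_rate L1 L2 C1 C2 R s (1/2 - \<mu>) (1/2 + \<mu>) (z t)) (at t)"
proof -
  have "((\<lambda>t. z t $ i) has_real_derivative (A_mat L1 L2 C1 C2 R \<mu> *v z t) $ i) (at t)" for i
    using bounded_linear.has_vector_derivative[OF bounded_linear_vec_nth z]
    by (simp add: has_real_derivative_iff_has_vector_derivative)
  note d = this[of 1] this[of 2] this[of 3] this[of 4]
  define v where "v = A_mat L1 L2 C1 C2 R \<mu> *v z t"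
  have v: "L1 * v $ 1 = - ((1/2 - \<mu>) * z t $ 3)" "L2 * v $ 2 = (1/2 + \<mu>) * z t $ 3 + z t $ 4"
    "C1 * v $ 3 = (1/2 - \<mu>) * z t $ 1 - (1/2 + \<mu>) * z t $ 2" "C2 * v $ 4 = - (z t $ 2 + z t $ 4 / R)"
    using pos by (simp_all add: v_def A_mat_mult_vector)
  have "((\<lambda>t. lyapunov L1 L2 C1 C2 s (z t)) has_real_derivative
      z t $ 1 * (L1 * v $ 1) + z t $ 2 * (L2 * v $ 2) + z t $ 3 * (C1 * v $ 3) + z t $ 4 * (C2 * v $ 4)
      + s^8 * (C2 * z t $ 4 * (L2 * v $ 2) + L2 * z t $ 2 * (C2 * v $ 4))
      - s^14 * (C1 * z t $ 3 * (L2 * v $ 2) + L2 * z t $ 2 * (C1 * v $ 3))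
      - s^18 * (C1 * z t $ 3 * (L1 * v $ 1) + L1 * z t $ 1 * (C1 * v $ 3))) (at t)"
    unfolding lyapunov_def
    by (rule d[folded v_def] DERIV_cdivide derivative_eq_intros refl)+ (simp add: algebra_simps)
  then show ?thesis
    unfolding v by (simp add: lyapunov_rate_def algebra_simps power2_eq_square)
qed

subsection \<open>Exponential decay\<close>

text \<open>With \<open>c = r / M\<close>, the upper bound on \<open>W\<close> makes
  \<open>exp (c * t) * W (z t)\<close> nonincreasing. Passing from \<open>W\<close> to the squared
  norm costs \<open>M / m\<close>; the final square root halves the rate.\<close>

lemma exponential_decay_of_strict_lyapunov_function:
  fixes W :: "'a::real_normed_vector \<Rightarrow> real"
  assumes "0 < m" "0 < M" "0 < r"
    and W: "\<And>x. m * (norm x)\<^sup>2 \<le> W x" "\<And>x. W x \<le> M * (norm x)\<^sup>2"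
    and ac: "\<And>t. absolutely_continuous_between (\<lambda>t. W (z t)) 0 t"
    and der: "AE t in lebesgue. \<exists>w \<le> - r * (norm (z t))\<^sup>2. ((\<lambda>t. W (z t)) has_real_derivative w) (at t)"
    and "0 \<le> t"
  shows "norm (z t) \<le> sqrt (M / m) * exp (- (r / (2 * M)) * t) * norm (z 0)"
proof -
  define c where "c = r / M"
  have "AE t in lebesgue. \<exists>g'\<le>0. ((\<lambda>t. exp (c * t) * W (z t)) has_real_derivative g') (at t)"
    using der
  proof eventually_elim
    case (elim t)
    then obtain w where w: "w \<le> - r * (norm (z t))\<^sup>2"
      "((\<lambda>t. W (z t)) has_real_derivative w) (at t)" by blast
    have "c * W (z t) \<le> c * (M * (norm (z t))\<^sup>2)"
      using W(2) assms(2,3) by (intro mult_left_mono) (auto simp: c_def)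
    also have "\<dots> = r * (norm (z t))\<^sup>2"
      using assms(2) by (simp add: c_def)
    finally have "c * W (z t) + w \<le> 0" using w(1) by simp
    then have "exp (c * t) * (c * W (z t) + w) \<le> 0"
      by (simp add: mult_le_0_iff)
    moreover have "((\<lambda>t. exp (c * t)) has_real_derivative exp (c * t) * c) (at t)"
      by (auto intro!: derivative_eq_intros)
    from DERIV_mult[OF this w(2)]
    have "((\<lambda>t. exp (c * t) * W (z t)) has_real_derivative exp (c * t) * (c * W (z t) + w)) (at t)"
      by (simp add: algebra_simps)
    ultimately show ?case by blast
  qed
  then have "exp (c * t) * W (z t) \<le> exp (c * 0) * W (z 0)"
    by (rule AE_nonpos_derivative_imp_decreasing[OF absolutely_continuous_between_mult[OF
        absolutely_continuous_between_exp ac] \<open>0 \<le> t\<close>])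
  then have "exp (- c * t) * (exp (c * t) * W (z t)) \<le> exp (- c * t) * W (z 0)"
    by (intro mult_left_mono) auto
  then have "W (z t) \<le> exp (- c * t) * W (z 0)"
    by (simp add: mult.assoc[symmetric] exp_add[symmetric])
  also have "\<dots> \<le> exp (- c * t) * (M * (norm (z 0))\<^sup>2)"
    by (intro mult_left_mono W) auto
  finally have "m * (norm (z t))\<^sup>2 \<le> exp (- c * t) * (M * (norm (z 0))\<^sup>2)"
    using W(1)[of "z t"] by linarith
  then have "(norm (z t))\<^sup>2 \<le> M / m * exp (- c * t) * (norm (z 0))\<^sup>2"
    using assms(1) by (simp add: field_simps)
  also have "exp (- c * t) = (exp (- (r / (2 * M)) * t))\<^sup>2"
    by (simp add: c_def power2_eq_square flip: exp_add)
  also have "M / m * (exp (- (r / (2 * M)) * t))\<^sup>2 * (norm (z 0))\<^sup>2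
      = (sqrt (M / m) * exp (- (r / (2 * M)) * t) * norm (z 0))\<^sup>2"
    using assms(1,2) by (simp add: power_mult_distrib)
  finally show ?thesis
    by (rule power2_le_imp_le) (use assms(1,2) in simp)
qed

theorem corollary1:
  fixes L1 L2 C1 C2 R Vin \<epsilon> \<mu>bar :: real
    and U :: "real set"
    and \<mu>star :: "real \<Rightarrow> real"
    and \<phi> :: "real \<Rightarrow> real ^ 4 \<Rightarrow> real ^ 4"
  assumes "L1 > 0" "L2 > 0" "C1 > 0" "C2 > 0" "R > 0"
    and "0 < \<epsilon>" "\<epsilon> \<le> 0.5"
    and "\<mu>bar = 0.5 - \<epsilon>"
    and "U = {-\<mu>bar..\<mu>bar}"
    and "\<And>t. \<mu>star t \<in> U"
    and "\<And>xo. caratheodory_solution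
           (\<lambda>t x. A_mat L1 L2 C1 C2 R (\<mu>star t) *v x + \<mu>star t *\<^sub>R B_vec L1 L2 C1 C2 Vin)
           (\<lambda>t. \<phi> t xo)"
    and "\<And>xo. \<phi> 0 xo = xo"
  shows "\<exists>K>0. \<exists>lam>0. \<forall>t\<ge>0. \<forall>xo yo.
           norm (\<phi> t xo - \<phi> t yo) \<le> K * exp (- lam * t) * norm (xo - yo)"
proof -
  note pos = assms(1-6)
  \<comment> \<open>\<open>m\<close> is a lower bound for the energy weights and for the
    coefficients of the good terms, with \<open>C1 * \<epsilon>\<close> and
    \<open>L1 * \<epsilon>\<close> standing in for \<open>C1 * b\<close> and
    \<open>L1 * a\<close>.\<close>
  define m where "m = min (1 / R) (min (min L1 L2) (min (min C1 C2) (min (C1 * \<epsilon>) (L1 * \<epsilon>))))"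
  \<comment> \<open>A sum of positive quantities dominates each of them, so \<open>M\<close> bounds
    all energy weights and cross coefficients at once.\<close>
  define M where "M = L1 + L2 + C1 + C2 + L2 / R + L2 * C2 + L2 * C1 + L1 * C1"
  \<comment> \<open>The cap 1 makes powers of \<open>s\<close> decrease in the exponent; the other
    entry gives \<open>16 * (M * s) <= m\<close>.\<close>
  define s where "s = min 1 (m / (16 * M))"
  have m: "m \<le> 1 / R" "m \<le> L1" "m \<le> L2" "m \<le> C1" "m \<le> C2" "m \<le> C1 * \<epsilon>" "m \<le> L1 * \<epsilon>"
    unfolding m_def by linarith+
  have "0 < m"
    using pos by (simp add: m_def)
  have prods: "0 < L2 / R" "0 < L2 * C2" "0 < L2 * C1" "0 < L1 * C1"
    using pos by simp_all
  have M: "L1 \<le> M" "L2 \<le> M" "C1 \<le> M" "C2 \<le> M" "L2 / R \<le> M" "L2 * C2 \<le> M" "L2 * C1 \<le> M" "L1 * C1 \<le> M"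
    unfolding M_def using pos prods by linarith+
  have "0 < M"
    using pos M(1) by linarith
  have s: "0 < s" "s \<le> 1" "16 * (M * s) \<le> m"
  proof -
    have "16 * M * s \<le> 16 * M * (m / (16 * M))"
      using \<open>0 < M\<close> by (intro mult_left_mono) (auto simp: s_def)
    then show "16 * (M * s) \<le> m" using \<open>0 < M\<close> by simp
  qed (use \<open>0 < m\<close> \<open>0 < M\<close> in \<open>auto simp: s_def\<close>)
  \<comment> \<open>\<open>m / 4\<close> and \<open>M\<close> come from
    \<open>lyapunov_bounds\<close>, the rate \<open>m / 2 * s^18\<close> from
    \<open>lyapunov_rate_le\<close>; all are fixed before the time and the initial states.\<close>
  define K where "K = sqrt (M / (m / 4))"
  define lam where "lam = (m / 2 * s^18) / (2 * M)"
  let ?W = "lyapunov L1 L2 C1 C2 s"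
  have "norm (\<phi> t xo - \<phi> t yo) \<le> K * exp (- lam * t) * norm (xo - yo)" if "0 \<le> t" for t xo yo
  proof -
    define z where "z = (\<lambda>t. \<phi> t xo - \<phi> t yo)"
    have sol: "locally_absolutely_continuous (\<lambda>t. \<phi> t x)"
      "AE t in lebesgue. ((\<lambda>t. \<phi> t x) has_vector_derivative A_mat L1 L2 C1 C2 R (\<mu>star t) *v \<phi> t x
         + \<mu>star t *\<^sub>R B_vec L1 L2 C1 C2 Vin) (at t)" for x
      using assms(11)[of x] by (auto simp: caratheodory_solution_def)
    have "absolutely_continuous_between z a b" for a b
      using sol(1)[of xo] sol(1)[of yo] unfolding z_def locally_absolutely_continuous_def
      by (intro absolutely_continuous_between_diff) auto
    then have ac: "absolutely_continuous_between (\<lambda>t. ?W (z t)) a b" for a b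
      by (rule absolutely_continuous_between_lyapunov)
    have der: "AE t in lebesgue. \<exists>w \<le> - (m / 2 * s^18) * (norm (z t))\<^sup>2.
        ((\<lambda>t. ?W (z t)) has_real_derivative w) (at t)"
      using sol(2)[of xo] sol(2)[of yo]
    proof eventually_elim
      case (elim t)
      \<comment> \<open>Both solutions are driven by the same input, so the terms with
        \<open>B_vec\<close> cancel in the difference.\<close>
      have "(z has_vector_derivative A_mat L1 L2 C1 C2 R (\<mu>star t) *v z t) (at t)"
        using has_vector_derivative_diff[OF elim]
        by (simp add: z_def matrix_vector_mult_diff_distrib)
      then have "((\<lambda>t. ?W (z t)) has_real_derivative
          lyapunov_rate L1 L2 C1 C2 R s (1/2 - \<mu>star t) (1/2 + \<mu>star t) (z t)) (at t)"
        by (rule lyapunov_has_derivative[OF pos(1-5)])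
      \<comment> \<open>Since \<open>\<mu>star t\<close> stays within
        \<open>1/2 - \<epsilon>\<close> of 0, both coupling coefficients are at least
        \<open>\<epsilon>\<close>.\<close>
      moreover have "\<epsilon> \<le> 1/2 - \<mu>star t" "1/2 - \<mu>star t \<le> 1" "\<epsilon> \<le> 1/2 + \<mu>star t" "1/2 + \<mu>star t \<le> 1"
        using assms(10)[of t] pos(6) by (auto simp: assms(8,9))
      then have "lyapunov_rate L1 L2 C1 C2 R s (1/2 - \<mu>star t) (1/2 + \<mu>star t) (z t)
          \<le> - (m / 2 * s^18) * (norm (z t))\<^sup>2"
        by (intro lyapunov_rate_le[where \<epsilon> = \<epsilon> and M = M]) (use pos m M s \<open>0 < m\<close> in auto)
      ultimately show ?case by blast
    qed
    have "norm (z t) \<le> K * exp (- lam * t) * norm (z 0)"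
      unfolding K_def lam_def
    proof (rule exponential_decay_of_strict_lyapunov_function[where W = ?W])
      show "m / 4 * (norm x)\<^sup>2 \<le> ?W x" "?W x \<le> M * (norm x)\<^sup>2" for x
        using \<open>0 < m\<close> m M s by (intro lyapunov_bounds; simp)+
    qed (use \<open>0 < m\<close> \<open>0 < M\<close> s(1) ac der that in auto)
    then show ?thesis by (simp add: z_def assms(12))
  qed
  moreover have "K > 0" "lam > 0"
    using \<open>0 < m\<close> \<open>0 < M\<close> s(1) by (auto simp: K_def lam_def)
  ultimately show ?thesis by blast
qed

end
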